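(* Let $p$ be an odd prime, $n\ge1$ an integer, $q=p^n$, and let $F(x)=x^{q-2}$ on $\mathbb{F}_q$, with $F(0)=0$. Let $\chi$ be the quadratic character of $\mathbb{F}_q$, extended by $\chi(0)=0$, and let $\Psi(z)=\zeta_p^{\mathrm{Tr}_1^n(z)}$ be the canonical additive character of $\mathbb{F}_q$. For $z\in\mathbb{F}_q^*$ define the Kloosterman sum $$\mathrm{Kl}(z)=\sum_{s\in\mathbb{F}_q^*}\Psi\left(s+\frac zs\right).$$ Then, for $c\in\mathbb{F}_q$, $$\mathrm{DDT}_F(1,c)=\begin{cases}0,&c=0,\\3+\chi(-3),&c=1,\\1+\chi(c^2-4c),&c\notin\{0,1\},\end{cases}$$ and, for all $u,v\in\mathbb{F}_q^*$ and $j\in\mathbb{F}_p$, writing $\lambda=vu^{-1}$, $$L_F(u,v;j)=-\mathbf{1}_{\{j=0\}}+2\cdot\mathbf{1}_{\{j=\mathrm{Tr}_1^n(\lambda)\}}-\frac1p+\frac1p\sum_{\alpha\in\mathbb{F}_p^*}\zeta_p^{-\alpha j}\,\Psi(2\alpha\lambda)\,\mathrm{Kl}(\alpha^2\lambda^2).$$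
   Context: $\zeta_p=e^{2\pi i/p}$; $\mathrm{Tr}_1^n$ is the absolute trace $\mathbb{F}_{p^n}\to\mathbb{F}_p$; a superscript $*$ denotes nonzero elements; $\mathbf{1}_{\{P\}}$ equals $1$ if $P$ holds and $0$ otherwise. The derivative is $D_uF(x)=F(x+u)-F(x)$, and $\mathrm{DDT}_F(u,b)=\#\{x\in\mathbb{F}_q:D_uF(x)=b\}$. The centered level count is $L_F(u,v;j)=\#\{x\in\mathbb{F}_q:\mathrm{Tr}_1^n(vD_uF(x))=j\}-p^{n-1}$. *)

theory Defs
  imports Complex_Main "HOL-Library.Cardinality" "HOL-Computational_Algebra.Primes"
begin

text \<open>
  The field with \<open>p ^ n\<close> elements is any type \<open>'a :: {field, finite}\<close> with \<open>CARD('a) = p ^ n\<close>;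
  \<open>p\<close> and \<open>n\<close> are passed explicitly where a definition depends on them.
  The field with \<open>p\<close> elements is the prime subfield of \<open>'a\<close>.
\<close>

definition prime_subfield :: "'a::{field,finite} set" where
  "prime_subfield = range of_int"

definition abs_trace :: "nat \<Rightarrow> nat \<Rightarrow> 'a::{field,finite} \<Rightarrow> 'a" where
  "abs_trace p n x = (\<Sum>i<n. x ^ (p ^ i))"

definition zeta :: "nat \<Rightarrow> complex" where
  "zeta p = exp (2 * of_real pi * \<i> / of_nat p)"

text \<open>The power of \<open>zeta p\<close> to an element \<open>a\<close> of the prime subfield, by way of the
  representative of \<open>a\<close> in \<open>{0, \<dots>, p - 1}\<close>; unspecified for other \<open>a\<close>.\<close>

definition zeta_pow :: "nat \<Rightarrow> 'a::{field,finite} \<Rightarrow> complex" where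
  "zeta_pow p a = zeta p ^ (THE k. k < p \<and> of_nat k = a)"

definition quad_char :: "'a::{field,finite} \<Rightarrow> int" where
  "quad_char x = (if x = 0 then 0 else if \<exists>y. x = y ^ 2 then 1 else - 1)"

definition add_char :: "nat \<Rightarrow> nat \<Rightarrow> 'a::{field,finite} \<Rightarrow> complex" where
  "add_char p n z = zeta_pow p (abs_trace p n z)"

definition Kloosterman :: "nat \<Rightarrow> nat \<Rightarrow> 'a::{field,finite} \<Rightarrow> complex" where
  "Kloosterman p n z = (\<Sum>s\<in>UNIV - {0}. add_char p n (s + z / s))"

definition derivative :: "'a::{field,finite} \<Rightarrow> ('a \<Rightarrow> 'a) \<Rightarrow> 'a \<Rightarrow> 'a" where
  "derivative u F x = F (x + u) - F x"

definition DDT :: "('a::{field,finite} \<Rightarrow> 'a) \<Rightarrow> 'a \<Rightarrow> 'a \<Rightarrow> nat" where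
  "DDT F u b = card {x. derivative u F x = b}"

definition level_count ::
    "nat \<Rightarrow> nat \<Rightarrow> ('a::{field,finite} \<Rightarrow> 'a) \<Rightarrow> 'a \<Rightarrow> 'a \<Rightarrow> 'a \<Rightarrow> int" where
  "level_count p n F u v j =
     int (card {x. abs_trace p n (v * derivative u F x) = j}) - int (p ^ (n - 1))"

end

theory Submission
  imports Defs "HOL-Computational_Algebra.Polynomial"
begin

text \<open>
  Away from \<open>x = 0\<close> and \<open>x = - 1\<close>, where the derivative in direction \<open>1\<close> is \<open>1\<close>, it takes the value
  \<open>c\<close> exactly at the roots of \<open>c * x ^ 2 + c * x + 1\<close>, which has discriminant \<open>c ^ 2 - 4 * c\<close>.
  For the level counts, orthogonality over the prime subfield expresses \<open>p\<close> times the count as a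
  sum of character sums of multiples of the derivative, and a fractional linear substitution
  identifies each of these sums with a Kloosterman sum, up to the two exceptional points \<open>0\<close>, \<open>- u\<close>
  and one value of the summation variable that the substitution misses.
\<close>

section \<open>Finite fields\<close>

text \<open>Multiplication by a nonzero \<open>x\<close> permutes the nonzero elements; comparing
  their products shows that \<open>x\<close> to the number of nonzero elements is
  \<open>1\<close>.\<close>

lemma finite_field_power_CARD:
  fixes x :: "'a::{field,finite}"
  shows "x ^ CARD('a) = x"
proof (cases "x = 0")
  case False
  have "(\<Prod>y\<in>UNIV-{0}. x * y) = (\<Prod>y\<in>UNIV-{0}. y)"
    by (rule prod.reindex_bij_witness[of _ "\<lambda>y. y / x" "\<lambda>y. x * y"]) (use False in auto)
  then have "x ^ card (UNIV - {0 :: 'a}) * \<Prod>(UNIV - {0}) = \<Prod>(UNIV - {0})"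
    by (simp add: prod.distrib)
  then have "x ^ card (UNIV - {0 :: 'a}) = 1"
    by simp
  moreover have "CARD('a) = Suc (card (UNIV - {0 :: 'a}))"
    by (rule card.remove) auto
  ultimately show ?thesis
    by (metis mult.right_neutral power_Suc)
qed simp

text \<open>Translation by \<open>1\<close> permutes the field, so summing all elements forces
  \<open>of_nat CARD('a)\<close> to vanish; hence \<open>of_nat p\<close> does too, as a field has
  no nilpotents.\<close>

lemma CHAR_eq_of_CARD:
  assumes "prime p" and "CARD('a::{field,finite}) = p ^ n"
  shows "CHAR('a) = p"
proof -
  have "(\<Sum>x\<in>UNIV. x + 1 :: 'a) = (\<Sum>x\<in>UNIV. x)"
    by (rule sum.reindex_bij_witness[of _ "\<lambda>x. x - 1" "\<lambda>x. x + 1"]) auto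
  then have "of_nat CARD('a) = (0 :: 'a)"
    by (simp add: sum.distrib)
  then have "of_nat p = (0 :: 'a)"
    using assms(2) by simp
  then have "CHAR('a) dvd p"
    by (simp add: of_nat_eq_0_iff_char_dvd)
  then show ?thesis
    using assms(1) CHAR_not_1'[where ?'a = 'a] by (auto simp: prime_nat_iff)
qed

section \<open>Counting roots of quadratics when \<open>2\<close> is invertible\<close>

lemma card_square_roots:
  fixes d :: "'a::{field,finite}"
  assumes "(2 :: 'a) \<noteq> 0"
  shows "int (card {y. y ^ 2 = d}) = 1 + quad_char d"
proof (cases "\<exists>y. d = y ^ 2")
  case True
  then obtain y where y: "d = y ^ 2" by blast
  have eq: "{z. z ^ 2 = d} = {y, - y}"
    by (auto simp: y power2_eq_iff)
  show ?thesis
  proof (cases "y = 0")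
    case False
    have "y \<noteq> - y"
    proof
      assume "y = - y"
      then have "2 * y = 0" by (metis add.right_inverse mult_2)
      with assms False show False by simp
    qed
    then show ?thesis using False eq by (auto simp: quad_char_def y)
  qed (use eq in \<open>simp add: quad_char_def y\<close>)
next
  case False
  then have "{y. y ^ 2 = d} = {}" "d \<noteq> 0" by (auto simp: zero_power2 intro: exI[of _ 0])
  then show ?thesis using False by (simp add: quad_char_def)
qed

text \<open>Completing the square: \<open>2 * a * x + b\<close> runs bijectively through the square
  roots of the discriminant as \<open>x\<close> runs through the roots.\<close>

lemma card_quadratic_roots:
  fixes a b c :: "'a::{field,finite}"
  assumes "(2 :: 'a) \<noteq> 0" "a \<noteq> 0"
  shows "int (card {x. a * x ^ 2 + b * x + c = 0}) = 1 + quad_char (b ^ 2 - 4 * a * c)"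
proof -
  have four: "(4 :: 'a) \<noteq> 0"
    using assms(1) by (metis mult_2 mult_eq_0_iff numeral_Bit0)
  have complete_square: "4 * a * (a * x ^ 2 + b * x + c) = (2 * a * x + b) ^ 2 - (b ^ 2 - 4 * a * c)" for x
    by (simp add: power2_eq_square algebra_simps)
  have iff: "a * x ^ 2 + b * x + c = 0 \<longleftrightarrow> (2 * a * x + b) ^ 2 = b ^ 2 - 4 * a * c" for x
    using complete_square[of x] four assms(2) by (metis mult_eq_0_iff right_minus_eq)
  have "bij_betw (\<lambda>x. 2 * a * x + b) {x. a * x ^ 2 + b * x + c = 0} {y. y ^ 2 = b ^ 2 - 4 * a * c}"
    by (rule bij_betw_byWitness[where f' = "\<lambda>y. (y - b) / (2 * a)"]) (use assms in \<open>auto simp: iff\<close>)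
  then show ?thesis
    using card_square_roots[OF assms(1)] by (simp add: bij_betw_same_card)
qed

section \<open>The prime subfield and the trace\<close>

context
  fixes p n :: nat
  assumes prime_p: "prime p" and CARD_a: "CARD('a::{field,finite}) = p ^ n"
begin

lemma CHAR_p: "CHAR('a) = p"
  using CHAR_eq_of_CARD prime_p CARD_a .

text \<open>Rules out \<open>n = 0\<close>, which matters because \<open>p ^ (n - 1)\<close> and
  \<open>p ^ n - 2\<close> use truncated subtraction.\<close>

lemma CARD_neq_1: "CARD('a) \<noteq> 1"
proof -
  have "card {0, 1 :: 'a} \<le> CARD('a)"
    by (rule card_mono) auto
  then show ?thesis by simp
qed

lemma p_pos: "p > 0"
  using prime_p by (simp add: prime_gt_0_nat)

lemma of_nat_mod_p: "of_nat (k mod p) = (of_nat k :: 'a)"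
proof -
  have "(of_nat k :: 'a) = of_nat (p * (k div p) + k mod p)"
    by simp
  also have "\<dots> = of_nat (k mod p)"
    using of_nat_CHAR[where ?'a = 'a] by (simp only: of_nat_add of_nat_mult CHAR_p) simp
  finally show ?thesis ..
qed

lemma inj_on_of_nat_p: "inj_on (of_nat :: nat \<Rightarrow> 'a) {..<p}"
proof (rule linorder_inj_onI)
  fix k l :: nat
  assume kl: "k < l" "k \<in> {..<p}" "l \<in> {..<p}"
  show "of_nat k \<noteq> (of_nat l :: 'a)"
  proof
    assume "of_nat k = (of_nat l :: 'a)"
    then have "of_nat (l - k) = (0 :: 'a)"
      using kl by (simp add: of_nat_diff)
    then have "p dvd l - k"
      by (simp add: of_nat_eq_0_iff_char_dvd CHAR_p)
    with kl show False by (auto dest: dvd_imp_le)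
  qed
qed auto

text \<open>The representatives below \<open>p\<close> are the exponents that
  \<open>zeta_pow\<close> selects.\<close>

lemma prime_subfield_eq: "prime_subfield = (of_nat ` {..<p} :: 'a set)"
proof
  show "prime_subfield \<subseteq> (of_nat ` {..<p} :: 'a set)"
  proof
    fix x :: 'a assume "x \<in> prime_subfield"
    then obtain m where m: "x = of_int m" by (auto simp: prime_subfield_def)
    have "(of_int m :: 'a) = of_int (int p * (m div int p) + m mod int p)"
      by simp
    also have "\<dots> = of_int (m mod int p)"
      using of_nat_CHAR[where ?'a = 'a] by (simp only: of_int_add of_int_mult CHAR_p of_int_of_nat_eq) simp
    also have "m mod int p = int (nat (m mod int p))"
      using p_pos by simp
    finally have "x = of_nat (nat (m mod int p))"
      using m by (metis of_int_of_nat_eq)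
    moreover have "nat (m mod int p) < p"
      using p_pos by (simp add: nat_less_iff)
    ultimately show "x \<in> of_nat ` {..<p}" by blast
  qed
  show "of_nat ` {..<p} \<subseteq> (prime_subfield :: 'a set)"
    by (auto simp: prime_subfield_def) (metis of_int_of_nat_eq rangeI)
qed

lemma card_prime_subfield: "card (prime_subfield :: 'a set) = p"
  by (simp add: prime_subfield_eq card_image inj_on_of_nat_p)

lemma prime_subfield_closed:
  fixes a b :: 'a
  assumes "a \<in> prime_subfield" "b \<in> prime_subfield"
  shows "a + b \<in> prime_subfield" "a - b \<in> prime_subfield" "a * b \<in> prime_subfield"
    "- a \<in> prime_subfield"
  using assms unfolding prime_subfield_def
  by (auto simp flip: of_int_add of_int_diff of_int_mult of_int_minus)

text \<open>Frobenius is additive and fixes \<open>0\<close> and \<open>1\<close>, hence every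
  \<open>of_nat k\<close>.\<close>

lemma prime_subfield_power:
  fixes a :: 'a
  assumes "a \<in> prime_subfield"
  shows "a ^ (p ^ i) = a"
proof -
  have "(of_nat k :: 'a) ^ (p ^ i) = of_nat k" for k
    using p_pos prime_p
    by (induction k) (simp_all add: power_0_left freshmans_dream'[where n = i] CHAR_p)
  then show ?thesis
    using assms by (auto simp: prime_subfield_eq)
qed

text \<open>The prime subfield already supplies \<open>p\<close> roots of \<open>X ^ p - X\<close>, so there are no others.\<close>

lemma prime_subfield_iff_power: "(a :: 'a) \<in> prime_subfield \<longleftrightarrow> a ^ p = a"
proof -
  define P :: "'a poly" where "P = monom 1 p - monom 1 1"
  have "p > 1" using prime_p by (rule prime_gt_1_nat)
  have "degree P \<le> p"
    unfolding P_def by (rule degree_diff_le) (use \<open>p > 1\<close> in \<open>auto simp: degree_monom_eq\<close>)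
  moreover have "coeff P p = 1"
    using \<open>p > 1\<close> by (simp add: P_def)
  then have "P \<noteq> 0" by auto
  moreover have roots: "{x. poly P x = 0} = {x. x ^ p = x}"
    by (simp add: P_def poly_monom)
  ultimately have "card {x :: 'a. x ^ p = x} \<le> p"
    using card_poly_roots_bound[of P] by simp
  moreover have "prime_subfield \<subseteq> {x :: 'a. x ^ p = x}"
    using prime_subfield_power[of _ 1] by auto
  ultimately have "prime_subfield = {x :: 'a. x ^ p = x}"
    by (intro card_seteq) (simp_all add: card_prime_subfield)
  then show ?thesis by blast
qed

lemma abs_trace_add: "abs_trace p n (x + y :: 'a) = abs_trace p n x + abs_trace p n y"
  using prime_p by (simp add: abs_trace_def freshmans_dream' CHAR_p sum.distrib)

lemma abs_trace_scale:
  "(a :: 'a) \<in> prime_subfield \<Longrightarrow> abs_trace p n (a * x) = a * abs_trace p n x"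
  by (simp add: abs_trace_def power_mult_distrib prime_subfield_power sum_distrib_left)

lemma abs_trace_0: "abs_trace p n (0 :: 'a) = 0"
  using p_pos by (simp add: abs_trace_def power_0_left)

text \<open>Raising to the power \<open>p\<close> permutes the conjugates cyclically, because
  \<open>x ^ (p ^ n)\<close> is \<open>x\<close> again; so the trace is a root of
  \<open>X ^ p - X\<close>.\<close>

lemma abs_trace_mem: "abs_trace p n (x :: 'a) \<in> prime_subfield"
proof -
  have "abs_trace p n x ^ p = (\<Sum>i<n. (x ^ (p ^ i)) ^ p)"
    using prime_p by (simp add: abs_trace_def freshmans_dream_sum CHAR_p)
  also have "\<dots> = (\<Sum>i<n. x ^ (p ^ Suc i))"
    by (simp add: mult.commute flip: power_mult)
  also have "\<dots> = (\<Sum>i<Suc n. x ^ (p ^ i)) - x"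
    by (subst sum.lessThan_Suc_shift) simp
  also have "\<dots> = abs_trace p n x"
    using finite_field_power_CARD[of x] by (simp add: abs_trace_def CARD_a)
  finally show ?thesis
    by (simp add: prime_subfield_iff_power)
qed

section \<open>Additive characters\<close>

lemma zeta_power_eq_cis: "zeta p ^ k = cis (2 * pi * real k / real p)"
proof -
  have "zeta p = cis (2 * pi / real p)"
    by (simp add: zeta_def cis_conv_exp mult_ac)
  then show ?thesis
    by (simp add: DeMoivre mult_ac)
qed

lemma zeta_power_p: "zeta p ^ p = 1"
  using p_pos by (simp add: zeta_power_eq_cis)

text \<open>Removes the definite description: any natural representative may serve as exponent,
  since both sides depend only on \<open>k mod p\<close>.\<close>

lemma zeta_pow_of_nat: "zeta_pow p (of_nat k :: 'a) = zeta p ^ k"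
proof -
  have "(THE m. m < p \<and> of_nat m = (of_nat k :: 'a)) = k mod p"
  proof (rule the_equality)
    show "k mod p < p \<and> of_nat (k mod p) = (of_nat k :: 'a)"
      using p_pos by (simp add: of_nat_mod_p)
    fix m assume "m < p \<and> of_nat m = (of_nat k :: 'a)"
    then show "m = k mod p"
      using inj_on_of_nat_p p_pos by (auto simp: of_nat_mod_p inj_on_def)
  qed
  moreover have "zeta p ^ k = zeta p ^ (p * (k div p) + k mod p)"
    by simp
  then have "zeta p ^ k = zeta p ^ (k mod p)"
    by (simp only: power_add power_mult zeta_power_p) simp
  ultimately show ?thesis
    by (simp add: zeta_pow_def)
qed

lemma zeta_pow_0: "zeta_pow p (0 :: 'a) = 1"
  using zeta_pow_of_nat[of 0] by simp

lemma zeta_pow_add: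
  fixes a b :: 'a
  assumes "a \<in> prime_subfield" "b \<in> prime_subfield"
  shows "zeta_pow p (a + b) = zeta_pow p a * zeta_pow p b"
proof -
  obtain k l where "a = of_nat k" "b = of_nat l"
    using assms by (auto simp: prime_subfield_eq)
  then show ?thesis
    using zeta_pow_of_nat[of "k + l"] by (simp add: zeta_pow_of_nat power_add)
qed

text \<open>\<open>zeta p\<close> is a primitive root of unity: its powers with exponents below
  \<open>p\<close> are distinct.\<close>

lemma zeta_pow_eq_1_iff:
  fixes a :: 'a
  assumes "a \<in> prime_subfield"
  shows "zeta_pow p a = 1 \<longleftrightarrow> a = 0"
proof
  assume a: "zeta_pow p a = 1"
  obtain k where k: "k < p" "a = of_nat k"
    using assms by (auto simp: prime_subfield_eq)
  have "inj_on (\<lambda>k. cis (2 * pi * real k / real p)) {..<p}"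
    using bij_betw_roots_unity[OF p_pos] by (simp add: bij_betw_def)
  moreover have "cis (2 * pi * real k / real p) = cis (2 * pi * real 0 / real p)"
    using a k by (simp add: zeta_pow_of_nat zeta_power_eq_cis)
  ultimately have "k = 0"
    by (rule inj_onD) (use k p_pos in auto)
  then show "a = 0" using k by simp
qed (simp add: zeta_pow_0)

section \<open>Orthogonality over the prime subfield\<close>

lemma sum_zeta_pow:
  fixes w :: 'a
  assumes w: "w \<in> prime_subfield"
  shows "(\<Sum>a\<in>prime_subfield. zeta_pow p (a * w)) = of_nat p * of_bool (w = 0)"
proof (cases "w = 0")
  case True
  then show ?thesis by (simp add: zeta_pow_0 card_prime_subfield)
next
  case False
  let ?S = "\<Sum>a\<in>prime_subfield. zeta_pow p (a * w)"
  have one: "(1 :: 'a) \<in> prime_subfield"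
    by (simp add: prime_subfield_iff_power)
  \<comment> \<open>Shifting the index by \<open>1\<close> multiplies the sum by
    \<open>zeta_pow p w\<close>, which differs from \<open>1\<close>.\<close>
  have "?S = (\<Sum>a\<in>prime_subfield. zeta_pow p ((a + 1) * w))"
    by (rule sum.reindex_bij_witness[of _ "\<lambda>a. a + 1" "\<lambda>a. a - 1"])
       (auto simp: prime_subfield_closed one)
  also have "\<dots> = (\<Sum>a\<in>prime_subfield. zeta_pow p (a * w) * zeta_pow p w)"
    by (intro sum.cong) (simp_all add: distrib_right zeta_pow_add prime_subfield_closed w)
  also have "\<dots> = ?S * zeta_pow p w"
    by (simp add: sum_distrib_right)
  finally have "?S = 0"
    using zeta_pow_eq_1_iff[OF w] False by simp
  then show ?thesis using False by simp
qed

lemma add_char_0: "add_char p n (0 :: 'a) = 1"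
  by (simp add: add_char_def abs_trace_0 zeta_pow_0)

lemma add_char_add: "add_char p n (x + y :: 'a) = add_char p n x * add_char p n y"
  by (simp add: add_char_def abs_trace_add zeta_pow_add abs_trace_mem)

text \<open>The trace is linear over the prime subfield, so the summand is
  \<open>zeta_pow p (a * w)\<close> with \<open>w = abs_trace p n x - j\<close>.\<close>

lemma sum_add_char_eq_indicator:
  fixes x j :: 'a
  assumes j: "j \<in> prime_subfield"
  shows "(\<Sum>a\<in>prime_subfield. zeta_pow p (- a * j) * add_char p n (a * x))
    = of_nat p * of_bool (abs_trace p n x = j)"
proof -
  have "zeta_pow p (- a * j) * add_char p n (a * x) = zeta_pow p (a * (abs_trace p n x - j))"
    if a: "a \<in> prime_subfield" for a
  proof -
    have "a * (abs_trace p n x - j) = - a * j + a * abs_trace p n x"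
      by (simp add: algebra_simps)
    then show ?thesis
      using zeta_pow_add[of "- a * j" "a * abs_trace p n x"]
      by (simp add: add_char_def abs_trace_scale[OF a] prime_subfield_closed a j abs_trace_mem)
  qed
  then show ?thesis
    using sum_zeta_pow[of "abs_trace p n x - j"] j
    by (simp add: prime_subfield_closed abs_trace_mem)
qed

section \<open>The inverse function\<close>

text \<open>The substitution \<open>s = - m * (x + u) / x\<close> with \<open>m = w / u\<close> turns \<open>w * (1 / (x + u) - 1 / x)\<close>
  into \<open>(s + m) ^ 2 / s = 2 * m + (s + m ^ 2 / s)\<close>. The value \<open>s = - m\<close> is not attained.\<close>

lemma sum_add_char_derivative_inverse:
  fixes u w :: 'a
  assumes "u \<noteq> 0" "w \<noteq> 0"
  shows "(\<Sum>x\<in>UNIV. add_char p n (w * derivative u inverse x))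
    = 2 * add_char p n (w / u) - 1 + add_char p n (2 * (w / u)) * Kloosterman p n ((w / u) ^ 2)"
proof -
  define m where "m = w / u"
  have m: "m \<noteq> 0" and w: "w = m * u"
    using assms by (auto simp: m_def)
  let ?f = "\<lambda>x. add_char p n (w * derivative u inverse x)"
  let ?g = "\<lambda>s. add_char p n (2 * m + (s + m ^ 2 / s))"
  have "(\<Sum>x\<in>UNIV. ?f x) = (\<Sum>x\<in>UNIV - {0, - u}. ?f x) + (\<Sum>x\<in>{0, - u}. ?f x)"
    by (rule sum.subset_diff) auto
  \<comment> \<open>With \<open>inverse 0 = 0\<close>, the derivative equals \<open>1 / u\<close> at
    both exceptional points.\<close>
  also have "(\<Sum>x\<in>{0, - u}. ?f x) = 2 * add_char p n m"
    using assms(1) by (simp add: derivative_def m_def field_simps)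
  also have "(\<Sum>x\<in>UNIV - {0, - u}. ?f x) = (\<Sum>s\<in>UNIV - {0, - m}. ?g s)"
  proof (rule sum.reindex_bij_witness[of _ "\<lambda>s. - (m * u) / (s + m)" "\<lambda>x. - m * (x + u) / x"])
    fix x assume x: "x \<in> UNIV - {0, - u}"
    then have nz: "x \<noteq> 0" "x + u \<noteq> 0" by (auto simp: eq_neg_iff_add_eq_0)
    have s: "- m * (x + u) / x + m = - (m * u) / x"
      using nz by (simp add: field_simps)
    show "- (m * u) / (- m * (x + u) / x + m) = x"
      unfolding s using nz m assms by simp
    show "- m * (x + u) / x \<in> UNIV - {0, - m}"
      using s nz m assms by (auto simp: eq_neg_iff_add_eq_0)
    have "2 * m + (- m * (x + u) / x + m ^ 2 / (- m * (x + u) / x)) = w * derivative u inverse x"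
      using nz m by (simp add: w derivative_def divide_simps) (simp add: power2_eq_square algebra_simps)
    then show "?g (- m * (x + u) / x) = ?f x" by simp
  next
    fix s assume s: "s \<in> UNIV - {0, - m}"
    then have nz: "s \<noteq> 0" "s + m \<noteq> 0" by (auto simp: eq_neg_iff_add_eq_0)
    have x: "- (m * u) / (s + m) + u = s * u / (s + m)"
      using nz by (simp add: field_simps)
    show "- m * (- (m * u) / (s + m) + u) / (- (m * u) / (s + m)) = s"
      unfolding x using nz m assms by simp
    show "- (m * u) / (s + m) \<in> UNIV - {0, - u}"
      using x nz m assms by (auto simp: eq_neg_iff_add_eq_0)
  qed
  also have "(\<Sum>s\<in>UNIV - {0, - m}. ?g s) = (\<Sum>s\<in>UNIV - {0} - {- m}. ?g s)"
    by (simp add: Diff_insert2[symmetric] insert_commute)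
  also have "\<dots> = (\<Sum>s\<in>UNIV - {0}. ?g s) - ?g (- m)"
    using m by (subst sum_diff1) auto
  \<comment> \<open>At the missed value the argument is \<open>2 * m - m - m = 0\<close>; this is
    the source of the \<open>- 1\<close>.\<close>
  also have "?g (- m) = 1"
    using m by (simp add: power2_eq_square add_char_0)
  also have "(\<Sum>s\<in>UNIV - {0}. ?g s) = add_char p n (2 * m) * Kloosterman p n (m ^ 2)"
    by (simp only: add_char_add[of "2 * m"] Kloosterman_def sum_distrib_left)
  finally show ?thesis
    by (simp add: m_def)
qed

text \<open>The exceptional points \<open>0\<close> and \<open>- 1\<close> both have derivative
  \<open>1\<close>, so they add two solutions to the quadratic count exactly when
  \<open>c = 1\<close>, where the discriminant is \<open>- 3\<close>.\<close>

lemma DDT_inverse: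
  fixes c :: 'a
  assumes "odd p"
  shows "int (DDT inverse 1 c) =
    (if c = 0 then 0
     else if c = 1 then 3 + quad_char (- 3 :: 'a)
     else 1 + quad_char (c ^ 2 - 4 * c))"
proof -
  have two: "(2 :: 'a) \<noteq> 0"
  proof
    assume "(2 :: 'a) = 0"
    then have "p dvd 2"
      using of_nat_eq_0_iff_char_dvd[of 2, where ?'a = 'a] by (simp add: CHAR_p)
    then show False
      using assms prime_p by (metis dvd_refl primes_dvd_imp_eq two_is_prime_nat)
  qed
  define R where "R = {x :: 'a. c * x ^ 2 + c * x + 1 = 0}"
  have generic: "derivative 1 inverse x = c \<longleftrightarrow> x \<in> R" if "x \<noteq> 0" "x \<noteq> - 1" for x
  proof -
    have nz: "x + 1 \<noteq> 0" using that by (simp add: eq_neg_iff_add_eq_0)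
    have "derivative 1 inverse x = - 1 / (x * (x + 1))"
      using that nz by (simp add: derivative_def field_simps)
    then have "derivative 1 inverse x = c \<longleftrightarrow> - 1 = c * (x * (x + 1))"
      using that nz by (simp only: divide_eq_eq) simp
    also have "\<dots> \<longleftrightarrow> c * (x * (x + 1)) + 1 = 0"
      by (metis add.commute add.right_inverse add_eq_0_iff)
    also have "c * (x * (x + 1)) + 1 = c * x ^ 2 + c * x + 1"
      by (simp add: power2_eq_square algebra_simps)
    finally show ?thesis by (simp add: R_def)
  qed
  have exceptional: "derivative 1 inverse (0 :: 'a) = 1" "derivative 1 inverse (- 1 :: 'a) = 1"
    by (simp_all add: derivative_def)
  \<comment> \<open>The quadratic takes the value \<open>1\<close> at both points, so nothing is
    counted twice.\<close>
  have not_R: "0 \<notin> R" "- 1 \<notin> R"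
    by (simp_all add: R_def)
  have card_R: "int (card R) = 1 + quad_char (c ^ 2 - 4 * c)" if "c \<noteq> 0"
    using card_quadratic_roots[OF two that, of c 1] by (simp add: R_def)
  show ?thesis
  proof (cases "c = 1")
    case True
    have "derivative 1 inverse x = c \<longleftrightarrow> x \<in> {0, - 1} \<union> R" for x
      using generic[of x] exceptional True by (cases "x = 0 \<or> x = - 1") auto
    then have "{x. derivative 1 inverse x = c} = {0, - 1} \<union> R"
      by blast
    moreover have "card ({0, - 1} \<union> R) = 2 + card R"
      using not_R by (subst card_Un_disjoint) auto
    ultimately show ?thesis
      using True card_R by (simp add: DDT_def)
  next
    case False
    have "derivative 1 inverse x = c \<longleftrightarrow> x \<in> R" for x
      using generic[of x] exceptional not_R False by (cases "x = 0 \<or> x = - 1") auto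
    then have "{x. derivative 1 inverse x = c} = R"
      by blast
    \<comment> \<open>Here the polynomial degenerates to the constant \<open>1\<close>, and the
      discriminant formula does not apply.\<close>
    moreover have "R = {}" if "c = 0"
      using that by (simp add: R_def)
    ultimately show ?thesis
      using False card_R by (auto simp: DDT_def)
  qed
qed

text \<open>The exceptional points produce the indicator of \<open>j = abs_trace p n l\<close>, and
  the missed substitution value produces that of \<open>j = 0\<close>. Both come from sums over
  nonzero indices, and completing these leaves \<open>- 2 + 1 = - 1\<close>, hence
  \<open>- 1 / of_nat p\<close>.\<close>

lemma level_count_inverse:
  fixes u v j :: 'a
  assumes u: "u \<noteq> 0" and v: "v \<noteq> 0" and j: "j \<in> prime_subfield"
  defines "l \<equiv> v / u"
  shows "complex_of_int (level_count p n inverse u v j) =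
    - of_bool (j = 0) + 2 * of_bool (j = abs_trace p n l) - 1 / of_nat p
    + 1 / of_nat p *
      (\<Sum>a\<in>prime_subfield - {0}. zeta_pow p (- a * j) *
         add_char p n (2 * a * l) * Kloosterman p n (a ^ 2 * l ^ 2))"
proof -
  let ?D = "derivative u inverse"
  let ?N = "card {x. abs_trace p n (v * ?D x) = j}"
  let ?K = "\<Sum>a\<in>prime_subfield - {0}. zeta_pow p (- a * j) *
         add_char p n (2 * a * l) * Kloosterman p n (a ^ 2 * l ^ 2)"
  have zero: "(0 :: 'a) \<in> prime_subfield"
    using p_pos by (simp add: prime_subfield_iff_power power_0_left)
  have split: "(\<Sum>a\<in>prime_subfield - {0}. g a) = (\<Sum>a\<in>prime_subfield. g a) - g 0"
    for g :: "'a \<Rightarrow> complex"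
    using zero by (simp add: sum_diff1)
  have sum_j: "(\<Sum>a\<in>prime_subfield - {0}. zeta_pow p (- a * j)) = of_nat p * of_bool (j = 0) - 1"
    using sum_add_char_eq_indicator[OF j, of 0]
    by (subst split) (auto simp: add_char_0 zeta_pow_0 abs_trace_0)
  have sum_l: "(\<Sum>a\<in>prime_subfield - {0}. zeta_pow p (- a * j) * add_char p n (a * l))
      = of_nat p * of_bool (j = abs_trace p n l) - 1"
    using sum_add_char_eq_indicator[OF j, of l]
    by (subst split) (auto simp: add_char_0 zeta_pow_0)
  have inner: "(\<Sum>x\<in>UNIV. add_char p n (a * (v * ?D x)))
      = 2 * add_char p n (a * l) - 1 + add_char p n (2 * a * l) * Kloosterman p n (a ^ 2 * l ^ 2)"
    if "a \<noteq> 0" for a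
    using sum_add_char_derivative_inverse[OF u, of "a * v"] that v
    by (simp add: l_def mult_ac power_mult_distrib power_divide)
  have "of_nat p * of_nat ?N = (\<Sum>x\<in>UNIV. of_nat p * of_bool (abs_trace p n (v * ?D x) = j) :: complex)"
    by (simp add: sum_distrib_left[symmetric] of_bool_def sum.If_cases)
  also have "\<dots> = (\<Sum>x\<in>UNIV. \<Sum>a\<in>prime_subfield. zeta_pow p (- a * j) * add_char p n (a * (v * ?D x)))"
    by (simp only: sum_add_char_eq_indicator[OF j])
  also have "\<dots> = (\<Sum>a\<in>prime_subfield. zeta_pow p (- a * j) * (\<Sum>x\<in>UNIV. add_char p n (a * (v * ?D x))))"
    by (subst sum.swap) (simp add: sum_distrib_left)
  \<comment> \<open>The index \<open>0\<close> contributes the size of the field, which the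
    centering in \<open>level_count\<close> cancels.\<close>
  also have "\<dots> = of_nat (p ^ n) +
      (\<Sum>a\<in>prime_subfield - {0}. zeta_pow p (- a * j) * (\<Sum>x\<in>UNIV. add_char p n (a * (v * ?D x))))"
    by (subst split) (simp add: zeta_pow_0 add_char_0 CARD_a)
  also have "(\<Sum>a\<in>prime_subfield - {0}. zeta_pow p (- a * j) * (\<Sum>x\<in>UNIV. add_char p n (a * (v * ?D x))))
      = (\<Sum>a\<in>prime_subfield - {0}. 2 * (zeta_pow p (- a * j) * add_char p n (a * l))
          - zeta_pow p (- a * j)
          + zeta_pow p (- a * j) * add_char p n (2 * a * l) * Kloosterman p n (a ^ 2 * l ^ 2))"
    by (intro sum.cong refl) (simp add: inner algebra_simps)
  also have "\<dots> = 2 * (of_nat p * of_bool (j = abs_trace p n l) - 1)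
      - (of_nat p * of_bool (j = 0) - 1) + ?K"
    by (simp only: sum.distrib sum_subtractf sum_distrib_left[symmetric] sum_j sum_l)
  finally have pN: "of_nat p * of_nat ?N = of_nat (p ^ n)
      + (2 * (of_nat p * of_bool (j = abs_trace p n l) - 1) - (of_nat p * of_bool (j = 0) - 1) + ?K)" .
  have "n \<noteq> 0"
    using CARD_neq_1 CARD_a by (metis power_0)
  then have q: "of_nat (p ^ n) = (of_nat p * of_nat (p ^ (n - 1)) :: complex)"
    by (simp flip: power_Suc)
  have "of_nat p * complex_of_int (level_count p n inverse u v j)
      = of_nat p * (- of_bool (j = 0) + 2 * of_bool (j = abs_trace p n l) - 1 / of_nat p
        + 1 / of_nat p * ?K)"
    using p_pos pN unfolding q level_count_def by (simp add: algebra_simps)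
  then show ?thesis
    using p_pos by simp
qed

text \<open>For nonzero \<open>x\<close>, cancel two factors in
  \<open>x ^ (p ^ n) = x\<close>.\<close>

lemma inverse_eq_power:
  assumes "odd p"
  shows "inverse = (\<lambda>x :: 'a. x ^ (p ^ n - 2))"
proof
  fix x :: 'a
  have "p ^ n \<noteq> 1"
    using CARD_neq_1 CARD_a by metis
  moreover have "odd (p ^ n)" using assms by simp
  \<comment> \<open>This keeps the exponent \<open>p ^ n - 2\<close> positive, so that both
    functions vanish at \<open>0\<close>.\<close>
  ultimately have "p ^ n \<ge> 3" by presburger
  then obtain k where k: "p ^ n = k + 3"
    by (metis add.commute le_Suc_ex)
  have "x * (x * x ^ Suc k) = x"
    using finite_field_power_CARD[of x] by (simp add: CARD_a k eval_nat_numeral)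
  then show "inverse x = x ^ (p ^ n - 2)"
    by (cases "x = 0") (auto simp: k eval_nat_numeral field_simps)
qed

end

theorem theorem4p9:
  fixes p n :: nat and F :: "'a::{field,finite} \<Rightarrow> 'a"
  assumes "prime p" and "odd p" and "n \<ge> 1"
    and "CARD('a) = p ^ n"
    and "F = (\<lambda>x. x ^ (p ^ n - 2))"
  shows "(\<forall>c. int (DDT F 1 c) =
            (if c = 0 then 0
             else if c = 1 then 3 + quad_char (- 3 :: 'a)
             else 1 + quad_char (c ^ 2 - 4 * c)))
       \<and> (\<forall>u v j. u \<noteq> 0 \<longrightarrow> v \<noteq> 0 \<longrightarrow> j \<in> prime_subfield \<longrightarrow>
            (let l = v * inverse u in
             complex_of_int (level_count p n F u v j) =
               - of_bool (j = 0) + 2 * of_bool (j = abs_trace p n l) - 1 / of_nat p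
               + 1 / of_nat p *
                 (\<Sum>\<alpha>\<in>prime_subfield - {0}. zeta_pow p (- \<alpha> * j) *
                    add_char p n (2 * \<alpha> * l) * Kloosterman p n (\<alpha> ^ 2 * l ^ 2))))"
proof -
  have F: "F = inverse"
    using inverse_eq_power[OF assms(1,4,2)] assms(5) by simp
  show ?thesis
    using DDT_inverse[OF assms(1,4,2)] level_count_inverse[OF assms(1,4)]
    unfolding F Let_def divide_inverse by blast
qed

end
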